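(* Let $X$ be a nonempty Hausdorff paracompact space admitting a fixed-point free involution $\tau$, and let $q:X\to X/\tau$ be the quotient map. Then the index of $\tau$ on $X$ is equal to $\mathrm{secat}(q)-1$.
   Context: For a Hausdorff space $X$ with a (continuous) fixed-point free involution $\tau$, the index of $\tau$ on $X$ is $\mathrm{ind}_{\mathbb{Z}_2}(X)=\min\{n\in\{0,1,2,\ldots\}: \text{there is a continuous } \mathbb{Z}_2\text{-equivariant map } X\to S^n\}$, where $\mathbb{Z}_2$ acts on $X$ by $\tau$ and on $S^n$ by the antipodal map $x\mapsto -x$; the index is $\infty$ if there is no such $n$. The quotient map $q$ is a 2-sheeted covering map. The sectional category $\mathrm{secat}(q)$ is the minimal cardinality of an open cover of $X/\tau$ such that over each member $U$ there is a continuous local section $s:U\to X$ (i.e. $q\circ s$ is the inclusion $U\hookrightarrow X/\tau$); $\mathrm{secat}(q)=\infty$ if no finite such cover exists. By convention $\infty-1=\infty$. *)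

theory Defs
  imports "HOL-Analysis.Analysis" "HOL-Analysis.Abstract_Euclidean_Space"
    "HOL-Library.Extended_Nat"
begin

text \<open>Hausdorffness is not included; it is a separate hypothesis.\<close>

definition paracompact_space :: "'a topology \<Rightarrow> bool" where
  "paracompact_space X \<longleftrightarrow>
    (\<forall>\<U>. (\<forall>U\<in>\<U>. openin X U) \<and> \<Union>\<U> = topspace X \<longrightarrow>
      (\<exists>\<V>. (\<forall>V\<in>\<V>. openin X V) \<and> \<Union>\<V> = topspace X \<and>
           (\<forall>V\<in>\<V>. \<exists>U\<in>\<U>. V \<subseteq> U) \<and> locally_finite_in X \<V>))"

definition fixed_point_free_involution :: "'a topology \<Rightarrow> ('a \<Rightarrow> 'a) \<Rightarrow> bool" where
  "fixed_point_free_involution X \<tau> \<longleftrightarrow>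
    continuous_map X X \<tau> \<and> (\<forall>x\<in>topspace X. \<tau> (\<tau> x) = x \<and> \<tau> x \<noteq> x)"

definition orbit_map :: "('a \<Rightarrow> 'a) \<Rightarrow> 'a \<Rightarrow> 'a set" where
  "orbit_map \<tau> x = {x, \<tau> x}"

definition orbit_space :: "'a topology \<Rightarrow> ('a \<Rightarrow> 'a) \<Rightarrow> 'a set topology" where
  "orbit_space X \<tau> = topology (\<lambda>U. U \<subseteq> orbit_map \<tau> ` topspace X \<and>
      openin X {x \<in> topspace X. orbit_map \<tau> x \<in> U})"

lemma openin_orbit_space:
  "openin (orbit_space X \<tau>) U \<longleftrightarrow>
    U \<subseteq> orbit_map \<tau> ` topspace X \<and> openin X {x \<in> topspace X. orbit_map \<tau> x \<in> U}"
proof -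
  have "istopology (\<lambda>U. U \<subseteq> orbit_map \<tau> ` topspace X \<and>
      openin X {x \<in> topspace X. orbit_map \<tau> x \<in> U})"
    unfolding istopology_def
  proof (intro conjI allI impI)
    fix S T
    assume S: "S \<subseteq> orbit_map \<tau> ` topspace X \<and> openin X {x \<in> topspace X. orbit_map \<tau> x \<in> S}"
      and T: "T \<subseteq> orbit_map \<tau> ` topspace X \<and> openin X {x \<in> topspace X. orbit_map \<tau> x \<in> T}"
    show "S \<inter> T \<subseteq> orbit_map \<tau> ` topspace X" using S by blast
    have "{x \<in> topspace X. orbit_map \<tau> x \<in> S \<inter> T} =
        {x \<in> topspace X. orbit_map \<tau> x \<in> S} \<inter> {x \<in> topspace X. orbit_map \<tau> x \<in> T}"
      by blast
    then show "openin X {x \<in> topspace X. orbit_map \<tau> x \<in> S \<inter> T}"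
      using S T by (simp add: openin_Int)
  next
    fix \<K>
    assume K: "\<forall>K\<in>\<K>. K \<subseteq> orbit_map \<tau> ` topspace X \<and>
        openin X {x \<in> topspace X. orbit_map \<tau> x \<in> K}"
    show "\<Union>\<K> \<subseteq> orbit_map \<tau> ` topspace X" using K by blast
    have "{x \<in> topspace X. orbit_map \<tau> x \<in> \<Union>\<K>} =
        (\<Union>K\<in>\<K>. {x \<in> topspace X. orbit_map \<tau> x \<in> K})"
      by blast
    then show "openin X {x \<in> topspace X. orbit_map \<tau> x \<in> \<Union>\<K>}"
      using K by auto
  qed
  then show ?thesis
    by (simp add: orbit_space_def topology_inverse')
qed

lemma topspace_orbit_space: "topspace (orbit_space X \<tau>) = orbit_map \<tau> ` topspace X"
proof
  show "topspace (orbit_space X \<tau>) \<subseteq> orbit_map \<tau> ` topspace X"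
    using openin_orbit_space openin_topspace by blast
  have "{x \<in> topspace X. orbit_map \<tau> x \<in> orbit_map \<tau> ` topspace X} = topspace X"
    by blast
  then have "openin (orbit_space X \<tau>) (orbit_map \<tau> ` topspace X)"
    by (simp add: openin_orbit_space)
  then show "orbit_map \<tau> ` topspace X \<subseteq> topspace (orbit_space X \<tau>)"
    by (rule openin_subset)
qed

lemma quotient_map_orbit_map: "quotient_map X (orbit_space X \<tau>) (orbit_map \<tau>)"
  by (auto simp: quotient_map_def topspace_orbit_space openin_orbit_space)

lemma orbit_map_eq_iff:
  assumes "fixed_point_free_involution X \<tau>" "x \<in> topspace X" "y \<in> topspace X"
  shows "orbit_map \<tau> x = orbit_map \<tau> y \<longleftrightarrow> y = x \<or> y = \<tau> x"
  using assms by (auto simp: orbit_map_def fixed_point_free_involution_def doubleton_eq_iff)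

text \<open>
  The unit sphere \<open>nsphere n\<close> of the library consists of sequences vanishing beyond index \<open>n\<close>,
  so its antipodal map is pointwise negation.
  In \<open>enat\<close>, the infimum of the empty set is \<open>\<infinity>\<close>, and any other infimum is attained.
\<close>

definition Z2_index :: "'a topology \<Rightarrow> ('a \<Rightarrow> 'a) \<Rightarrow> enat" where
  "Z2_index X \<tau> = Inf {enat n |n.
      \<exists>f. continuous_map X (nsphere n) f \<and> (\<forall>x\<in>topspace X. f (\<tau> x) = (\<lambda>i. - f x i))}"

definition has_local_section :: "'a topology \<Rightarrow> 'b topology \<Rightarrow> ('a \<Rightarrow> 'b) \<Rightarrow> 'b set \<Rightarrow> bool" where
  "has_local_section E B p U \<longleftrightarrow>
    (\<exists>s. continuous_map (subtopology B U) E s \<and> (\<forall>b\<in>U. p (s b) = b))"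

definition secat :: "'a topology \<Rightarrow> 'b topology \<Rightarrow> ('a \<Rightarrow> 'b) \<Rightarrow> enat" where
  "secat E B p = Inf {enat (card \<U>) |\<U>. finite \<U> \<and> \<Union>\<U> = topspace B \<and>
      (\<forall>U\<in>\<U>. openin B U \<and> has_local_section E B p U)}"

end

theory Submission
  imports Defs
begin

text \<open>
  The link between sections and spheres is a \<^emph>\<open>sheet\<close>: an open set \<open>A\<close> that is disjoint from
  \<open>\<tau> ` A\<close>. An open set of orbits has a continuous section exactly when it is the image of a sheet,
  namely of the range of the section (\<open>has_local_section_sheet\<close>, \<open>local_section_imp_sheet\<close>).
  So a cover of the orbit space by \<open>n + 1\<close> open sets with sections amounts to \<open>n + 1\<close> sheets which,
  together with their translates, cover \<open>X\<close>. Such families correspond to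
  equivariant maps to the \<open>n\<close>-sphere.

  Given an equivariant \<open>f\<close>, each set \<open>{x. f x i > 0}\<close> with \<open>i \<le> n\<close> is a sheet, whose translate is
  \<open>{x. f x i < 0}\<close>; they cover because some coordinate of a point of the sphere is nonzero.

  Conversely, let sheets \<open>A i\<close> be given. A paracompact Hausdorff space is normal, so the sets
  \<open>A i \<union> \<tau> ` A i\<close> can be shrunk to closed sets \<open>C i\<close> that still cover. On \<open>C i\<close> the two halves
  lying in \<open>A i\<close> and in \<open>\<tau> ` A i\<close> are closed and disjoint, hence separated by a Urysohn function,
  whose antisymmetrisation \<open>g x - g (\<tau> x)\<close> is odd and does not vanish on \<open>C i\<close>. The resulting
  \<open>n + 1\<close> odd functions have no common zero, and normalising their tuple gives the equivariant map.
  Working with odd functions on \<open>X\<close> itself avoids both a partition of unity and the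
  separation properties of the orbit space.
\<close>

section \<open>Paracompact Hausdorff spaces are normal\<close>

text \<open>
  Separation of \<open>B\<close> from the points of a closed set \<open>A\<close> extends to separation of \<open>B\<close> from \<open>A\<close>: the
  members of a locally finite refinement that meet \<open>A\<close> each have closure disjoint from \<open>B\<close>, and for a
  locally finite family the closure of the union is the union of the closures. Applied first
  to a single point \<open>B\<close> and then to a closed set \<open>B\<close>, this takes a Hausdorff space to a regular
  space and then to a normal one.
\<close>

lemma paracompact_space_separation:
  assumes para: "paracompact_space X" and A: "closedin X A" and B: "B \<subseteq> topspace X"
    and sep: "\<And>a. a \<in> A \<Longrightarrow> \<exists>U W. openin X U \<and> openin X W \<and> a \<in> U \<and> B \<subseteq> W \<and> disjnt U W"
  shows "\<exists>U W. openin X U \<and> openin X W \<and> A \<subseteq> U \<and> B \<subseteq> W \<and> disjnt U W"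
proof -
  define \<U> where "\<U> = insert (topspace X - A)
    {U. openin X U \<and> (\<exists>W. openin X W \<and> B \<subseteq> W \<and> disjnt U W)}"
  have "\<forall>U\<in>\<U>. openin X U"
    using A by (auto simp: \<U>_def)
  moreover have "\<Union>\<U> = topspace X"
  proof
    show "\<Union>\<U> \<subseteq> topspace X"
      using \<open>\<forall>U\<in>\<U>. openin X U\<close> openin_subset by blast
    show "topspace X \<subseteq> \<Union>\<U>"
    proof
      fix x assume x: "x \<in> topspace X"
      show "x \<in> \<Union>\<U>"
      proof (cases "x \<in> A")
        case True
        from sep[OF this] show ?thesis by (auto simp: \<U>_def)
      next
        case False
        with x show ?thesis by (auto simp: \<U>_def)
      qed
    qed
  qed
  ultimately obtain \<V> where \<V>: "\<forall>V\<in>\<V>. openin X V" "\<Union>\<V> = topspace X"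
      "\<forall>V\<in>\<V>. \<exists>U\<in>\<U>. V \<subseteq> U" "locally_finite_in X \<V>"
    using para[unfolded paracompact_space_def, rule_format, of \<U>] by blast
  define \<W> where "\<W> = {V \<in> \<V>. V \<inter> A \<noteq> {}}"
  have lf: "locally_finite_in X \<W>"
    using \<V>(4) by (rule locally_finite_in_subset) (auto simp: \<W>_def)
  have B_clo: "B \<inter> X closure_of V = {}" if V: "V \<in> \<W>" for V
  proof -
    obtain U where U: "U \<in> \<U>" "V \<subseteq> U"
      using V \<V>(3) by (auto simp: \<W>_def)
    \<comment> \<open>The added member of the cover does not meet \<open>A\<close>, so it cannot contain \<open>V\<close>.\<close>
    have "U \<noteq> topspace X - A"
      using V U by (auto simp: \<W>_def)
    with U(1) obtain W where "openin X W" "B \<subseteq> W" "disjnt U W"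
      by (auto simp: \<U>_def)
    then have "W \<inter> X closure_of V = {}"
      using U(2) by (subst openin_Int_closure_of_eq_empty) (auto simp: disjnt_def)
    with \<open>B \<subseteq> W\<close> show ?thesis by blast
  qed
  have "B \<inter> X closure_of (\<Union>\<W>) = {}"
    using B_clo by (auto simp: closure_of_locally_finite_Union[OF lf])
  moreover have open_W: "openin X (\<Union>\<W>)"
    using \<V>(1) by (auto simp: \<W>_def)
  moreover have "A \<subseteq> \<Union>\<W>"
    using \<V>(2) closedin_subset[OF A] by (fastforce simp: \<W>_def)
  moreover have "disjnt (\<Union>\<W>) (topspace X - X closure_of (\<Union>\<W>))"
    using closure_of_subset[OF openin_subset[OF open_W]] by (auto simp: disjnt_def)
  ultimately show ?thesis
    using B by (intro exI[of _ "\<Union>\<W>"] exI[of _ "topspace X - X closure_of (\<Union>\<W>)"]) auto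
qed

lemma paracompact_Hausdorff_imp_normal_space:
  assumes para: "paracompact_space X" and haus: "Hausdorff_space X"
  shows "normal_space X"
proof -
  have regular: "\<exists>U W. openin X U \<and> openin X W \<and> A \<subseteq> U \<and> {b} \<subseteq> W \<and> disjnt U W"
    if A: "closedin X A" and b: "b \<in> topspace X - A" for A b
  proof (rule paracompact_space_separation[OF para A])
    fix a assume "a \<in> A"
    then have "a \<in> topspace X" "a \<noteq> b"
      using b closedin_subset[OF A] by auto
    then show "\<exists>U W. openin X U \<and> openin X W \<and> a \<in> U \<and> {b} \<subseteq> W \<and> disjnt U W"
      using haus b unfolding Hausdorff_space_def by auto
  qed (use b in auto)
  show ?thesis
    unfolding normal_space_def
  proof clarify
    fix S T assume S: "closedin X S" and T: "closedin X T" and "disjnt S T"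
    show "\<exists>U V. openin X U \<and> openin X V \<and> S \<subseteq> U \<and> T \<subseteq> V \<and> disjnt U V"
    proof (rule paracompact_space_separation[OF para S closedin_subset[OF T]])
      fix a assume "a \<in> S"
      then have "a \<in> topspace X - T"
        using \<open>disjnt S T\<close> closedin_subset[OF S] by (auto simp: disjnt_iff)
      from regular[OF T this]
      show "\<exists>U W. openin X U \<and> openin X W \<and> a \<in> U \<and> T \<subseteq> W \<and> disjnt U W"
        by (metis disjnt_sym insert_subset)
    qed
  qed
qed

section \<open>Closed shrinkings of finite open covers\<close>

text \<open>
  One set is shrunk at a time: the part of \<open>S\<close> that only \<open>V j\<close> covers is closed, so normality gives
  an open \<open>G\<close> around it with closure inside \<open>V j\<close>, and the remaining sets cover the closed set
  \<open>S - G\<close>. The induction therefore has to treat a closed subset \<open>S\<close> instead of the whole space.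
\<close>

lemma normal_space_finite_closed_shrinking:
  assumes "finite I" "normal_space X" "\<And>i. i \<in> I \<Longrightarrow> openin X (V i)"
    and "closedin X S" "S \<subseteq> (\<Union>i\<in>I. V i)"
  shows "\<exists>C. (\<forall>i\<in>I. closedin X (C i) \<and> C i \<subseteq> V i) \<and> S \<subseteq> (\<Union>i\<in>I. C i)"
  using assms(1,3-)
proof (induction I arbitrary: S rule: finite_induct)
  case empty
  then show ?case by auto
next
  case (insert j I)
  have "closedin X (S - (\<Union>i\<in>I. V i))"
    by (rule closedin_diff[OF insert.prems(2) openin_Union]) (use insert.prems(1) in blast)
  moreover have "S - (\<Union>i\<in>I. V i) \<subseteq> V j"
    using insert.prems by auto
  ultimately obtain G where G: "openin X G" "S - (\<Union>i\<in>I. V i) \<subseteq> G" "X closure_of G \<subseteq> V j"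
    using assms(2)[unfolded normal_space_alt, rule_format, of "S - (\<Union>i\<in>I. V i)" "V j"]
      insert.prems(1)[of j] by auto
  have "\<exists>C. (\<forall>i\<in>I. closedin X (C i) \<and> C i \<subseteq> V i) \<and> S - G \<subseteq> (\<Union>i\<in>I. C i)"
  proof (rule insert.IH)
    show "closedin X (S - G)"
      using insert.prems(2) G(1) by (rule closedin_diff)
  qed (use insert.prems G in auto)
  then obtain C where C: "\<forall>i\<in>I. closedin X (C i) \<and> C i \<subseteq> V i" "S - G \<subseteq> (\<Union>i\<in>I. C i)"
    by blast
  have "G \<subseteq> X closure_of G"
    using G(1) by (simp add: closure_of_subset openin_subset)
  then show ?case
    using C G \<open>j \<notin> I\<close> by (intro exI[of _ "C(j := X closure_of G)"]) auto
qed

section \<open>Sheets of the orbit map\<close>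

text \<open>
  These are the open sets that the orbit map sends homeomorphically onto an open set of orbits, so a
  set \<open>orbit_map \<tau> ` A\<close> is evenly covered by \<open>A\<close> and \<open>\<tau> ` A\<close>.
\<close>

definition sheet :: "'a topology \<Rightarrow> ('a \<Rightarrow> 'a) \<Rightarrow> 'a set \<Rightarrow> bool" where
  "sheet X \<tau> A \<longleftrightarrow> openin X A \<and> A \<inter> \<tau> ` A = {}"

context
  fixes X :: "'a topology" and \<tau> :: "'a \<Rightarrow> 'a"
  assumes inv: "fixed_point_free_involution X \<tau>"
begin

lemma involution_continuous: "continuous_map X X \<tau>"
  using inv by (simp add: fixed_point_free_involution_def)

lemma involution_involutive: "x \<in> topspace X \<Longrightarrow> \<tau> (\<tau> x) = x"
  using inv by (simp add: fixed_point_free_involution_def)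

lemma involution_no_fixed_point: "x \<in> topspace X \<Longrightarrow> \<tau> x \<noteq> x"
  using inv by (simp add: fixed_point_free_involution_def)

lemma involution_in_topspace: "x \<in> topspace X \<Longrightarrow> \<tau> x \<in> topspace X"
  using involution_continuous by (auto simp: continuous_map_def)

lemma involution_image_eq_preimage:
  assumes "A \<subseteq> topspace X"
  shows "\<tau> ` A = {x \<in> topspace X. \<tau> x \<in> A}"
  using assms by (force simp: involution_in_topspace involution_involutive image_iff)

lemma openin_involution_image: "openin X A \<Longrightarrow> openin X (\<tau> ` A)"
  using openin_continuous_map_preimage[OF involution_continuous]
  by (simp add: involution_image_eq_preimage openin_subset)

lemma closedin_involution_image: "closedin X A \<Longrightarrow> closedin X (\<tau> ` A)"
  using closedin_continuous_map_preimage[OF involution_continuous]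
  by (simp add: involution_image_eq_preimage closedin_subset)

lemma orbit_map_preimage_image:
  assumes "A \<subseteq> topspace X"
  shows "{x \<in> topspace X. orbit_map \<tau> x \<in> orbit_map \<tau> ` A} = A \<union> \<tau> ` A"
proof -
  have "orbit_map \<tau> x \<in> orbit_map \<tau> ` A \<longleftrightarrow> x \<in> A \<or> \<tau> x \<in> A" if x: "x \<in> topspace X" for x
  proof -
    have "orbit_map \<tau> x = orbit_map \<tau> y \<longleftrightarrow> y = x \<or> y = \<tau> x" if "y \<in> A" for y
      using orbit_map_eq_iff[OF inv x] assms that by blast
    then show ?thesis by (auto simp: image_iff)
  qed
  then show ?thesis
    using assms by (auto simp: involution_image_eq_preimage)
qed

lemma openin_orbit_space_image:
  assumes "openin X A"
  shows "openin (orbit_space X \<tau>) (orbit_map \<tau> ` A)"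
  using assms openin_involution_image[OF assms] openin_subset[OF assms]
  by (auto simp: openin_orbit_space orbit_map_preimage_image)

text \<open>
  The orbit map is injective on a sheet and, as \<open>openin_orbit_space_image\<close> says, open; so its inverse
  there is continuous.
\<close>

lemma has_local_section_sheet:
  assumes A: "sheet X \<tau> A"
  shows "has_local_section X (orbit_space X \<tau>) (orbit_map \<tau>) (orbit_map \<tau> ` A)"
proof -
  have op: "openin X A" and disj: "A \<inter> \<tau> ` A = {}" and sub: "A \<subseteq> topspace X"
    using A openin_subset by (auto simp: sheet_def)
  have inj: "inj_on (orbit_map \<tau>) A"
  proof (rule inj_onI)
    fix x y assume xy: "x \<in> A" "y \<in> A" "orbit_map \<tau> x = orbit_map \<tau> y"
    then have "y = x \<or> y = \<tau> x"
      using orbit_map_eq_iff[OF inv] sub by blast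
    with xy disj show "x = y" by blast
  qed
  define s where "s = inv_into A (orbit_map \<tau>)"
  have s: "s (orbit_map \<tau> x) = x" if "x \<in> A" for x
    using inj that by (simp add: s_def)
  have "continuous_map (subtopology (orbit_space X \<tau>) (orbit_map \<tau> ` A)) X s"
    unfolding continuous_map
  proof (intro conjI allI impI)
    have top: "topspace (subtopology (orbit_space X \<tau>) (orbit_map \<tau> ` A)) = orbit_map \<tau> ` A"
      using sub by (auto simp: topspace_orbit_space)
    show "s ` topspace (subtopology (orbit_space X \<tau>) (orbit_map \<tau> ` A)) \<subseteq> topspace X"
      unfolding top using s sub by auto
    fix W assume W: "openin X W"
    have "{b \<in> orbit_map \<tau> ` A. s b \<in> W} = orbit_map \<tau> ` (A \<inter> W)"
      using s by auto
    moreover have "openin (orbit_space X \<tau>) (orbit_map \<tau> ` (A \<inter> W))"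
      using op W by (intro openin_orbit_space_image openin_Int)
    ultimately show "openin (subtopology (orbit_space X \<tau>) (orbit_map \<tau> ` A))
        {x \<in> topspace (subtopology (orbit_space X \<tau>) (orbit_map \<tau> ` A)). s x \<in> W}"
      unfolding top by (auto simp: openin_subtopology)
  qed
  then show ?thesis
    unfolding has_local_section_def using s by auto
qed

text \<open>
  The sheet is the range of the section \<open>s\<close>. Over \<open>U\<close> the maps \<open>s \<circ> orbit_map \<tau>\<close> and \<open>\<tau>\<close> agree
  exactly off this range, and two continuous maps into a Hausdorff space agree on a closed set;
  hence the range is open.
\<close>

lemma local_section_imp_sheet:
  assumes haus: "Hausdorff_space X" and U: "openin (orbit_space X \<tau>) U"
    and "has_local_section X (orbit_space X \<tau>) (orbit_map \<tau>) U"
  shows "\<exists>A. sheet X \<tau> A \<and> U = orbit_map \<tau> ` A"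
proof -
  obtain s where cont: "continuous_map (subtopology (orbit_space X \<tau>) U) X s"
    and s: "\<And>b. b \<in> U \<Longrightarrow> orbit_map \<tau> (s b) = b"
    using assms(3) by (auto simp: has_local_section_def)
  define V where "V = {x \<in> topspace X. orbit_map \<tau> x \<in> U}"
  define A where "A = {x \<in> V. s (orbit_map \<tau> x) = x}"
  have V_open: "openin X V" and U_sub: "U \<subseteq> orbit_map \<tau> ` topspace X"
    using U by (auto simp: V_def openin_orbit_space)
  have s_top: "s b \<in> topspace X" if "b \<in> U" for b
    using cont that U_sub by (auto simp: continuous_map_def topspace_orbit_space)
  have either: "s (orbit_map \<tau> x) = x \<or> s (orbit_map \<tau> x) = \<tau> x" if "x \<in> V" for x
    using that s[of "orbit_map \<tau> x"] s_top[of "orbit_map \<tau> x"]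
      orbit_map_eq_iff[OF inv, of x "s (orbit_map \<tau> x)"] by (auto simp: V_def)
  have tau_V: "orbit_map \<tau> (\<tau> x) = orbit_map \<tau> x" if "x \<in> topspace X" for x
    using that by (auto simp: orbit_map_def involution_involutive)
  have "continuous_map (subtopology X V) (orbit_space X \<tau>) (orbit_map \<tau>)"
    using quotient_map_orbit_map quotient_imp_continuous_map continuous_map_from_subtopology by blast
  then have "continuous_map (subtopology X V) (subtopology (orbit_space X \<tau>) U) (orbit_map \<tau>)"
    by (auto simp: continuous_map_in_subtopology V_def)
  from continuous_map_compose[OF this cont]
  have "continuous_map (subtopology X V) X (s \<circ> orbit_map \<tau>)" .
  moreover have "continuous_map (subtopology X V) X \<tau>"
    by (simp add: continuous_map_from_subtopology involution_continuous)
  ultimately have "closedin (subtopology X V) {x \<in> topspace (subtopology X V). (s \<circ> orbit_map \<tau>) x = \<tau> x}"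
    by (rule closedin_continuous_maps_eq[OF haus])
  then have "openin (subtopology X V) (topspace (subtopology X V) -
      {x \<in> topspace (subtopology X V). (s \<circ> orbit_map \<tau>) x = \<tau> x})"
    by blast
  moreover have "topspace (subtopology X V) -
      {x \<in> topspace (subtopology X V). (s \<circ> orbit_map \<tau>) x = \<tau> x} = A"
    using either involution_no_fixed_point by (force simp: A_def V_def)
  ultimately have "openin X A"
    using V_open openin_trans_full by metis
  moreover have "A \<inter> \<tau> ` A = {}"
    using tau_V involution_no_fixed_point unfolding A_def V_def by fastforce
  moreover have "U = orbit_map \<tau> ` A"
  proof
    show "U \<subseteq> orbit_map \<tau> ` A"
    proof
      fix b assume b: "b \<in> U"
      then have "s b \<in> A" "b = orbit_map \<tau> (s b)"
        using s s_top by (auto simp: A_def V_def)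
      then show "b \<in> orbit_map \<tau> ` A" by blast
    qed
  qed (auto simp: A_def V_def)
  ultimately show ?thesis
    by (auto simp: sheet_def)
qed

section \<open>Sheets and equivariant maps to spheres\<close>

text \<open>
  A Urysohn function that is \<open>1\<close> on the part of \<open>C\<close> in \<open>A\<close> and \<open>-1\<close> on the part in \<open>\<tau> ` A\<close> becomes
  odd on subtracting its translate. The two contributions cannot cancel on \<open>C\<close> once \<open>C\<close> has been
  replaced by the invariant set \<open>D = C \<union> \<tau> ` C\<close>.
\<close>

lemma odd_function_on_sheet:
  assumes norm: "normal_space X" and A: "sheet X \<tau> A"
    and C: "closedin X C" and sub: "C \<subseteq> A \<union> \<tau> ` A"
  shows "\<exists>h. continuous_map X euclideanreal h \<and> (\<forall>x\<in>topspace X. h (\<tau> x) = - h x) \<and>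
             (\<forall>x\<in>C. h x \<noteq> 0)"
proof -
  have op: "openin X A" and disj: "A \<inter> \<tau> ` A = {}" and subA: "A \<subseteq> topspace X"
    using A openin_subset by (auto simp: sheet_def)
  define D where "D = C \<union> \<tau> ` C"
  have D: "closedin X D"
    using C by (simp add: D_def closedin_involution_image closedin_Un)
  have "\<tau> ` C \<subseteq> \<tau> ` A \<union> \<tau> ` \<tau> ` A"
    using sub by blast
  also have "\<tau> ` \<tau> ` A = A"
    using subA by (force simp: image_image involution_involutive)
  finally have D_sub: "D \<subseteq> A \<union> \<tau> ` A"
    using sub by (auto simp: D_def)
  have D_tau: "\<tau> x \<in> D" if "x \<in> D" for x
    using that closedin_subset[OF C] by (auto simp: D_def involution_involutive)
  \<comment> \<open>Inside \<open>D\<close>, the set \<open>A\<close> is the complement of the open set \<open>\<tau> ` A\<close> and vice versa.\<close>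
  have "closedin X (D - \<tau> ` A)" "closedin X (D - A)" "disjnt (D - \<tau> ` A) (D - A)"
    using D op openin_involution_image[OF op] D_sub
    by (auto simp: closedin_diff disjnt_iff)
  then obtain g where g: "continuous_map X euclideanreal g"
      "g ` (D - \<tau> ` A) \<subseteq> {1}" "g ` (D - A) \<subseteq> {-1}"
    using Urysohn_lemma_alt[OF norm] by metis
  define h where "h x = g x - g (\<tau> x)" for x
  have "continuous_map X euclideanreal h"
    unfolding h_def using continuous_map_compose[OF involution_continuous g(1)]
    by (intro continuous_map_diff g) (simp add: o_def)
  moreover have "h (\<tau> x) = - h x" if "x \<in> topspace X" for x
    using that by (simp add: h_def involution_involutive)
  moreover have "h x \<noteq> 0" if "x \<in> C" for x
  proof -
    have x: "x \<in> D" "\<tau> x \<in> D" "x \<in> topspace X"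
      using that D_tau closedin_subset[OF C] by (auto simp: D_def)
    show ?thesis
    proof (cases "x \<in> A")
      case True
      then have "x \<in> D - \<tau> ` A" "\<tau> x \<in> D - A"
        using x disj by auto
      then show ?thesis using g by (force simp: h_def)
    next
      case False
      then have "x \<in> \<tau> ` A" using x D_sub by auto
      then have "\<tau> x \<in> A" using subA by (auto simp: involution_involutive)
      then have "x \<in> D - A" "\<tau> x \<in> D - \<tau> ` A"
        using False x disj by auto
      then show ?thesis using g by (force simp: h_def)
    qed
  qed
  ultimately show ?thesis by blast
qed

lemma equivariant_map_from_odd_functions:
  fixes h :: "nat \<Rightarrow> 'a \<Rightarrow> real"
  assumes cont: "\<And>i. i \<le> n \<Longrightarrow> continuous_map X euclideanreal (h i)"
    and odd: "\<And>i x. i \<le> n \<Longrightarrow> x \<in> topspace X \<Longrightarrow> h i (\<tau> x) = - h i x"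
    and nz: "\<And>x. x \<in> topspace X \<Longrightarrow> \<exists>i\<le>n. h i x \<noteq> 0"
  shows "\<exists>f. continuous_map X (nsphere n) f \<and> (\<forall>x\<in>topspace X. f (\<tau> x) = (\<lambda>i. - f x i))"
proof -
  define N where "N x = sqrt (\<Sum>i\<le>n. (h i x)\<^sup>2)" for x
  define f where "f x = (\<lambda>i. if i \<le> n then h i x / N x else 0)" for x
  have pos: "(\<Sum>i\<le>n. (h i x)\<^sup>2) > 0" if "x \<in> topspace X" for x
    using nz[OF that] by (auto intro!: sum_pos2)
  have N_cont: "continuous_map X euclideanreal N"
    unfolding N_def
    by (intro continuous_map_sqrt continuous_map_sum continuous_map_real_pow cont) auto
  have N_nz: "N x \<noteq> 0" if "x \<in> topspace X" for x
    using pos[OF that] by (simp add: N_def)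
  have "continuous_map X euclideanreal (\<lambda>x. f x i)" for i
    using cont[of i] N_cont N_nz by (auto simp: f_def intro: continuous_map_real_divide)
  moreover have "(\<Sum>i\<le>n. (f x i)\<^sup>2) = 1" if x: "x \<in> topspace X" for x
  proof -
    have "(\<Sum>i\<le>n. (f x i)\<^sup>2) = (\<Sum>i\<le>n. (h i x)\<^sup>2) / (N x)\<^sup>2"
      by (simp add: f_def power_divide sum_divide_distrib)
    then show ?thesis using pos[OF x] by (simp add: N_def)
  qed
  ultimately have "continuous_map X (nsphere n) f"
    unfolding nsphere continuous_map_in_subtopology continuous_map_componentwise_UNIV
    by (auto simp: f_def)
  moreover have "f (\<tau> x) = (\<lambda>i. - f x i)" if "x \<in> topspace X" for x
    using that odd by (auto simp: f_def N_def)
  ultimately show ?thesis by blast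
qed

lemma equivariant_map_from_sheets:
  assumes norm: "normal_space X" and A: "\<And>i. i \<le> n \<Longrightarrow> sheet X \<tau> (A i)"
    and cover: "topspace X \<subseteq> (\<Union>i\<le>n. A i \<union> \<tau> ` A i)"
  shows "\<exists>f. continuous_map X (nsphere n) f \<and> (\<forall>x\<in>topspace X. f (\<tau> x) = (\<lambda>i. - f x i))"
proof -
  have "\<exists>C. (\<forall>i\<in>{..n}. closedin X (C i) \<and> C i \<subseteq> A i \<union> \<tau> ` A i) \<and> topspace X \<subseteq> (\<Union>i\<in>{..n}. C i)"
    using cover A
    by (intro normal_space_finite_closed_shrinking norm)
       (auto simp: sheet_def openin_involution_image)
  then obtain C where C: "\<And>i. i \<le> n \<Longrightarrow> closedin X (C i) \<and> C i \<subseteq> A i \<union> \<tau> ` A i"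
      "topspace X \<subseteq> (\<Union>i\<le>n. C i)"
    by auto
  have "\<forall>i\<in>{..n}. \<exists>h. continuous_map X euclideanreal h \<and> (\<forall>x\<in>topspace X. h (\<tau> x) = - h x) \<and>
             (\<forall>x\<in>C i. h x \<noteq> 0)"
    using C A odd_function_on_sheet[OF norm] by (meson atMost_iff)
  then obtain h where h: "\<And>i. i \<le> n \<Longrightarrow> continuous_map X euclideanreal (h i)"
      "\<And>i x. i \<le> n \<Longrightarrow> x \<in> topspace X \<Longrightarrow> h i (\<tau> x) = - h i x"
      "\<And>i x. i \<le> n \<Longrightarrow> x \<in> C i \<Longrightarrow> h i x \<noteq> 0"
    by (metis atMost_iff)
  show ?thesis
    using h C(2) by (intro equivariant_map_from_odd_functions[of n h]) blast+
qed

lemma sheets_from_equivariant_map: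
  assumes f: "continuous_map X (nsphere n) f"
    and odd: "\<And>x. x \<in> topspace X \<Longrightarrow> f (\<tau> x) = (\<lambda>i. - f x i)"
  defines "A \<equiv> \<lambda>i. {x \<in> topspace X. f x i > 0}"
  shows "sheet X \<tau> (A i)" and "topspace X \<subseteq> (\<Union>i\<le>n. A i \<union> \<tau> ` A i)"
proof -
  have "continuous_map X euclideanreal (\<lambda>x. f x i)"
    using continuous_map_compose[OF f continuous_map_nsphere_projection] by (simp add: o_def)
  from openin_continuous_map_preimage[OF this, of "{0<..}"]
  have "openin X (A i)" by (simp add: A_def)
  then show "sheet X \<tau> (A i)"
    using odd by (auto simp: sheet_def A_def)
  show "topspace X \<subseteq> (\<Union>i\<le>n. A i \<union> \<tau> ` A i)"
  proof
    fix x assume x: "x \<in> topspace X"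
    then have "(\<Sum>i\<le>n. (f x i)\<^sup>2) = 1"
      using f by (auto simp: nsphere continuous_map_in_subtopology)
    then obtain i where i: "i \<le> n" "f x i \<noteq> 0"
      by (metis (no_types, lifting) atMost_iff power_zero_numeral sum.neutral zero_neq_one)
    have "x \<in> A i \<or> x \<in> \<tau> ` A i"
      using x i odd[OF x]
      by (subst involution_image_eq_preimage) (auto simp: A_def involution_in_topspace)
    with i show "x \<in> (\<Union>i\<le>n. A i \<union> \<tau> ` A i)" by blast
  qed
qed

text \<open>
  Different coordinates may give the same open set of orbits, so the cover may have fewer than
  \<open>n + 1\<close> members and only an inequality results.
\<close>

lemma secat_le_of_equivariant_map:
  assumes "continuous_map X (nsphere n) f" "\<And>x. x \<in> topspace X \<Longrightarrow> f (\<tau> x) = (\<lambda>i. - f x i)"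
  shows "secat X (orbit_space X \<tau>) (orbit_map \<tau>) \<le> enat (Suc n)"
proof -
  define A where "A i = {x \<in> topspace X. f x i > 0}" for i
  note sheets = sheets_from_equivariant_map[OF assms, folded A_def]
  define \<U> where "\<U> = (\<lambda>i. orbit_map \<tau> ` A i) ` {..n}"
  have sections: "openin (orbit_space X \<tau>) U \<and> has_local_section X (orbit_space X \<tau>) (orbit_map \<tau>) U"
    if "U \<in> \<U>" for U
    using that sheets(1) has_local_section_sheet openin_orbit_space_image
    by (auto simp: \<U>_def sheet_def)
  moreover have "\<Union>\<U> = topspace (orbit_space X \<tau>)"
  proof
    show "\<Union>\<U> \<subseteq> topspace (orbit_space X \<tau>)"
      using sections openin_subset by blast
    show "topspace (orbit_space X \<tau>) \<subseteq> \<Union>\<U>"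
    proof
      fix b assume "b \<in> topspace (orbit_space X \<tau>)"
      then obtain x where x: "x \<in> topspace X" "b = orbit_map \<tau> x"
        by (auto simp: topspace_orbit_space)
      with sheets(2) obtain i where i: "i \<le> n" "x \<in> A i \<union> \<tau> ` A i"
        by blast
      have "A i \<subseteq> topspace X" by (auto simp: A_def)
      from orbit_map_preimage_image[OF this] i(2) x have "b \<in> orbit_map \<tau> ` A i"
        by blast
      with i(1) show "b \<in> \<Union>\<U>"
        by (auto simp: \<U>_def)
    qed
  qed
  moreover have fin: "finite \<U>"
    by (simp add: \<U>_def)
  ultimately have "secat X (orbit_space X \<tau>) (orbit_map \<tau>) \<le> enat (card \<U>)"
    unfolding secat_def by (intro Inf_lower) blast
  also have "card \<U> \<le> Suc n"
    unfolding \<U>_def using card_image_le[of "{..n}"] by simp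
  finally show ?thesis by simp
qed

lemma Z2_index_le_of_section_cover:
  assumes "topspace X \<noteq> {}" and haus: "Hausdorff_space X" and norm: "normal_space X"
    and fin: "finite \<U>" and cover: "\<Union>\<U> = topspace (orbit_space X \<tau>)"
    and sections: "\<And>U. U \<in> \<U> \<Longrightarrow>
      openin (orbit_space X \<tau>) U \<and> has_local_section X (orbit_space X \<tau>) (orbit_map \<tau>) U"
  shows "Z2_index X \<tau> \<le> enat (card \<U>) - 1"
proof -
  have "\<U> \<noteq> {}"
    using cover assms(1) by (auto simp: topspace_orbit_space)
  \<comment> \<open>A nonempty space needs at least one set, so the subtraction in \<open>enat\<close> is not truncated.\<close>
  then obtain n where n: "card \<U> = Suc n"
    using fin by (metis card_eq_0_iff not0_implies_Suc)
  then obtain u where u: "u ` {..n} = \<U>"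
    using ex_bij_betw_nat_finite[OF fin] by (metis atLeast0LessThan bij_betw_imp_surj_on lessThan_Suc_atMost)
  have "\<forall>i\<in>{..n}. \<exists>A. sheet X \<tau> A \<and> u i = orbit_map \<tau> ` A"
    using u sections local_section_imp_sheet[OF haus] by blast
  then obtain A where A: "\<And>i. i \<le> n \<Longrightarrow> sheet X \<tau> (A i) \<and> u i = orbit_map \<tau> ` A i"
    by (metis atMost_iff)
  have "topspace X \<subseteq> (\<Union>i\<le>n. A i \<union> \<tau> ` A i)"
  proof
    fix x assume x: "x \<in> topspace X"
    then have "orbit_map \<tau> x \<in> \<Union>\<U>"
      by (simp add: cover topspace_orbit_space)
    then obtain i where i: "i \<le> n" "orbit_map \<tau> x \<in> orbit_map \<tau> ` A i"
      using u A by auto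
    moreover have "A i \<subseteq> topspace X"
      using A[OF i(1)] openin_subset by (auto simp: sheet_def)
    ultimately show "x \<in> (\<Union>i\<le>n. A i \<union> \<tau> ` A i)"
      using x orbit_map_preimage_image[of "A i"] by blast
  qed
  with A obtain f where "continuous_map X (nsphere n) f" "\<forall>x\<in>topspace X. f (\<tau> x) = (\<lambda>i. - f x i)"
    using equivariant_map_from_sheets[OF norm, of n A] by blast
  then have "Z2_index X \<tau> \<le> enat n"
    unfolding Z2_index_def by (intro Inf_lower) blast
  then show ?thesis
    by (simp add: n flip: eSuc_enat)
qed

end

section \<open>The index and the sectional category\<close>

text \<open>
  Both invariants are infima, and those in \<open>enat\<close> are minima as soon as they are finite: each
  inequality below starts from an optimal map or an optimal cover.
\<close>

lemma enat_Inf_attained: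
  fixes S :: "enat set"
  assumes "Inf S \<noteq> \<infinity>"
  shows "Inf S \<in> S"
  using assms by (auto simp: Inf_enat_def intro: LeastI split: if_splits)

theorem theorem3p39:
  fixes X :: "'a topology" and \<tau> :: "'a \<Rightarrow> 'a"
  assumes "topspace X \<noteq> {}"
    and "Hausdorff_space X"
    and "paracompact_space X"
    and "fixed_point_free_involution X \<tau>"
  shows "Z2_index X \<tau> = secat X (orbit_space X \<tau>) (orbit_map \<tau>) - 1"
proof (rule antisym)
  let ?secat = "secat X (orbit_space X \<tau>) (orbit_map \<tau>)"
  have norm: "normal_space X"
    using assms by (simp add: paracompact_Hausdorff_imp_normal_space)
  show "Z2_index X \<tau> \<le> ?secat - 1"
  proof (cases "?secat = \<infinity>")
    case False
    then have "?secat \<in> {enat (card \<U>) |\<U>. finite \<U> \<and> \<Union>\<U> = topspace (orbit_space X \<tau>) \<and>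
        (\<forall>U\<in>\<U>. openin (orbit_space X \<tau>) U \<and>
          has_local_section X (orbit_space X \<tau>) (orbit_map \<tau>) U)}"
      unfolding secat_def by (rule enat_Inf_attained)
    then show ?thesis
      using Z2_index_le_of_section_cover[OF assms(4,1,2) norm] by auto
  qed simp
  show "?secat - 1 \<le> Z2_index X \<tau>"
  proof (cases "Z2_index X \<tau> = \<infinity>")
    case False
    then have "Z2_index X \<tau> \<in> {enat n |n.
        \<exists>f. continuous_map X (nsphere n) f \<and> (\<forall>x\<in>topspace X. f (\<tau> x) = (\<lambda>i. - f x i))}"
      unfolding Z2_index_def by (rule enat_Inf_attained)
    then obtain n where n: "Z2_index X \<tau> = enat n" "?secat \<le> enat (Suc n)"
      using secat_le_of_equivariant_map[OF assms(4)] by auto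
    then show ?thesis
      by (cases ?secat) (auto simp: one_enat_def)
  qed simp
qed

end
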